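(* Consider the iterative temperature limiter, defined in the context, on one high-order element with $N_p$ solution points, started from data with positive density and temperature at all points. 1. The limiter is conservative: at each iteration $\sum_{a=1}^{N_p}\mathcal P_a\hat{\bf U}_a$ is unchanged. 2. The limiter is elementwise entropy dissipative: at each iteration $\sum_{a=1}^{N_p}\mathcal P_aJ_a\mathcal S({\bf U}_a)$ does not increase. 3. For every $m\ge1$, $$\max_aT^{(m)}_a-\min_aT_a^{(m)}\ \le\ \left(\max_aT^{(0)}_a-\min_aT^{(0)}_a\right)\prod_{n=1}^m\left(1-\frac{\gamma-1}{R_g}\,\frac{(\theta^t)^{(n)}}{\max_a\left(J_a\mathcal P_a\frac{\rho_a}{\rho_{\min}}\right)}\right).$$ 4. The iterative method converges, and upon convergence the temperature at all solution points satisfies $$\tilde\lambda_a\,\frac{|T_a-\bar{\bar T}|}{T_a\bar{\bar T}}\le\frac{\bar{\bar\rho}_H\,h}{\mu}\qquad\text{for all }a.$$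
   Context: Gas: ${\bf U}=(\rho,\rho\vec V,\rho E)$, $E=\frac{R_gT}{\gamma-1}+\frac12\|\vec V\|^2$, $R_g>0$, $\gamma>1$; $s=\frac{R_g}{\gamma-1}\log T-R_g\log\rho$ (up to a constant), $\mathcal S=-\rho s$; speed of sound $c(T)=\sqrt{\gamma R_gT}$, $c_a=c(T_a)$. On the element the solution points are indexed by $a=1,\dots,N_p$, with mass-matrix weight $\mathcal P_a>0$, Jacobian $J_a>0$, and $\hat{\bf U}_a=J_a{\bf U}_a$. For a quantity $q$, $\bar{\bar q}=\frac1{N_p}\sum_aq_a$. $\rho_{\min}=\min_a\rho_a$; at point $a$, $\bar{\bar\rho}_H$ is the harmonic average of $\rho_a$ and $\bar{\bar\rho}$. $\mu>0$ is the physical viscosity coefficient, $h>0$ a reference length of the element, and $$\tilde\lambda_a=\frac{\|\vec V_a+\bar{\bar{\vec V}}\|}2+\frac{c_a+c(\bar{\bar T})}2 .$$ One iteration of the limiter. Using current values (those at iteration $m-1$), for each point $a$: if $\tilde\lambda_a\frac{|T_a-\bar{\bar T}|}{T_a\bar{\bar T}}>\frac{\bar{\bar\rho}_Hh}\mu$, set $$\theta^t_a=J_a\mathcal P_a\frac{\rho_a}{\rho_{\min}}\frac{R_g}{\gamma-1}\left(1-\frac{T_a\bar{\bar T}}{|T_a-\bar{\bar T}|}\frac{\bar{\bar\rho}_Hh}{\tilde\lambda_a\mu}\right),$$ otherwise $\theta^t_a=0$. Set $$\theta^t=(\theta^t)^{(m)}=\min\left(\max_a\theta^t_a,\ \frac{R_g}{\gamma-1}\min_a\left(J_a\mathcal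 P_a\frac{\rho_a}{\rho_{\min}}\right)\right),$$ and update at every point $$\hat{\bf U}_a\leftarrow\hat{\bf U}_a+\frac{\theta^t}{\mathcal P_a}\,\rho_{\min}\,[0,0,0,0,\bar{\bar T}-T_a]^\top ,$$ which changes neither density nor velocity and gives $T^{(m)}_a-\bar{\bar T}^{(m-1)}=(T_a^{(m-1)}-\bar{\bar T}^{(m-1)})\left(1-\frac{\gamma-1}{R_g}\frac{\theta^t\rho_{\min}}{J_a\mathcal P_a\rho_a}\right)$. Averages are recomputed and the procedure is repeated. Superscript $(m)$ denotes values after $m$ iterations, $(0)$ the initial data. *)

theory Defs
  imports "HOL-Analysis.Analysis"
begin

text \<open>Conservative variables at a point: \<open>(\<rho>, \<rho> V, \<rho> E)\<close> with three velocity components.\<close>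

type_synonym cons_state = "real \<times> (real^3) \<times> real"

definition mass_density :: "cons_state \<Rightarrow> real" where
  "mass_density U = fst U"

definition velocity :: "cons_state \<Rightarrow> real^3" where
  "velocity U = fst (snd U) /\<^sub>R mass_density U"

definition total_energy :: "cons_state \<Rightarrow> real" where
  "total_energy U = snd (snd U) / mass_density U"

text \<open>The relation \<open>E = Rg T / (\<gamma> - 1) + |V|\<^sup>2 / 2\<close>, solved for \<open>T\<close>
  (see \<open>temperature_of_primitive\<close> below).\<close>

definition temperature :: "real \<Rightarrow> real \<Rightarrow> cons_state \<Rightarrow> real" where
  "temperature Rg \<gamma> U = (\<gamma> - 1) / Rg * (total_energy U - (norm (velocity U))\<^sup>2 / 2)"

lemma temperature_of_primitive:
  fixes V :: "real^3"
  assumes "Rg > 0" "\<gamma> > 1" "\<rho> > 0"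
  shows "temperature Rg \<gamma> (\<rho>, \<rho> *\<^sub>R V, \<rho> * (Rg * T / (\<gamma> - 1) + (norm V)\<^sup>2 / 2)) = T"
  using assms by (simp add: temperature_def total_energy_def velocity_def mass_density_def)

definition sound_speed :: "real \<Rightarrow> real \<Rightarrow> real \<Rightarrow> real" where
  "sound_speed Rg \<gamma> T = sqrt (\<gamma> * Rg * T)"

text \<open>The specific entropy is only defined up to an additive constant, here \<open>s0\<close>.\<close>

definition specific_entropy :: "real \<Rightarrow> real \<Rightarrow> real \<Rightarrow> cons_state \<Rightarrow> real" where
  "specific_entropy Rg \<gamma> s0 U =
     Rg / (\<gamma> - 1) * ln (temperature Rg \<gamma> U) - Rg * ln (mass_density U) + s0"

definition math_entropy :: "real \<Rightarrow> real \<Rightarrow> real \<Rightarrow> cons_state \<Rightarrow> real" where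
  "math_entropy Rg \<gamma> s0 U = - mass_density U * specific_entropy Rg \<gamma> s0 U"

text \<open>The solution points of the element form a finite type \<open>'p\<close>, with \<open>N\<^sub>p = CARD('p)\<close>.
  Below, \<open>U\<close> stands for the point states and \<open>Uh\<close> for the Jacobian-scaled states
  \<open>J a *\<^sub>R U a\<close>.\<close>

definition avg :: "('p::finite \<Rightarrow> 'b::real_vector) \<Rightarrow> 'b" where
  "avg q = (\<Sum>a\<in>UNIV. q a) /\<^sub>R real CARD('p)"

definition harmonic_avg :: "real \<Rightarrow> real \<Rightarrow> real" where
  "harmonic_avg x y = 2 / (1 / x + 1 / y)"

definition rho_min :: "('p::finite \<Rightarrow> cons_state) \<Rightarrow> real" where
  "rho_min U = (MIN a. mass_density (U a))"

definition rho_H :: "('p::finite \<Rightarrow> cons_state) \<Rightarrow> 'p \<Rightarrow> real" where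
  "rho_H U a = harmonic_avg (mass_density (U a)) (avg (\<lambda>b. mass_density (U b)))"

definition avg_temperature :: "real \<Rightarrow> real \<Rightarrow> ('p::finite \<Rightarrow> cons_state) \<Rightarrow> real" where
  "avg_temperature Rg \<gamma> U = avg (\<lambda>a. temperature Rg \<gamma> (U a))"

definition lambda_tilde ::
  "real \<Rightarrow> real \<Rightarrow> ('p::finite \<Rightarrow> cons_state) \<Rightarrow> 'p \<Rightarrow> real" where
  "lambda_tilde Rg \<gamma> U a =
     norm (velocity (U a) + avg (\<lambda>b. velocity (U b))) / 2
     + (sound_speed Rg \<gamma> (temperature Rg \<gamma> (U a))
        + sound_speed Rg \<gamma> (avg_temperature Rg \<gamma> U)) / 2"

definition mass_ratio ::
  "('p::finite \<Rightarrow> real) \<Rightarrow> ('p \<Rightarrow> real) \<Rightarrow> ('p \<Rightarrow> cons_state) \<Rightarrow> 'p \<Rightarrow> real" where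
  "mass_ratio J P U a = J a * P a * (mass_density (U a) / rho_min U)"

definition theta_point ::
  "real \<Rightarrow> real \<Rightarrow> real \<Rightarrow> real \<Rightarrow> ('p::finite \<Rightarrow> real) \<Rightarrow> ('p \<Rightarrow> real)
     \<Rightarrow> ('p \<Rightarrow> cons_state) \<Rightarrow> 'p \<Rightarrow> real" where
  "theta_point Rg \<gamma> \<mu> h J P U a =
     (let T = temperature Rg \<gamma> (U a);
          Tb = avg_temperature Rg \<gamma> U;
          lam = lambda_tilde Rg \<gamma> U a
      in if lam * (\<bar>T - Tb\<bar> / (T * Tb)) > rho_H U a * h / \<mu>
         then mass_ratio J P U a * (Rg / (\<gamma> - 1))
              * (1 - T * Tb / \<bar>T - Tb\<bar> * (rho_H U a * h / (lam * \<mu>)))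
         else 0)"

definition limiter_theta ::
  "real \<Rightarrow> real \<Rightarrow> real \<Rightarrow> real \<Rightarrow> ('p::finite \<Rightarrow> real) \<Rightarrow> ('p \<Rightarrow> real)
     \<Rightarrow> ('p \<Rightarrow> cons_state) \<Rightarrow> real" where
  "limiter_theta Rg \<gamma> \<mu> h J P U =
     min (MAX a. theta_point Rg \<gamma> \<mu> h J P U a)
         (Rg / (\<gamma> - 1) * (MIN a. mass_ratio J P U a))"

text \<open>One iteration, as a map on the scaled states.\<close>

definition limiter_step ::
  "real \<Rightarrow> real \<Rightarrow> real \<Rightarrow> real \<Rightarrow> ('p::finite \<Rightarrow> real) \<Rightarrow> ('p \<Rightarrow> real)
     \<Rightarrow> ('p \<Rightarrow> cons_state) \<Rightarrow> 'p \<Rightarrow> cons_state" where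
  "limiter_step Rg \<gamma> \<mu> h J P Uh =
     (let U = (\<lambda>a. Uh a /\<^sub>R J a)
      in (\<lambda>a. Uh a + (limiter_theta Rg \<gamma> \<mu> h J P U / P a * rho_min U)
              *\<^sub>R (0, 0, avg_temperature Rg \<gamma> U - temperature Rg \<gamma> (U a))))"

end

theory Submission
  imports Defs
begin

text \<open>One iteration leaves density and velocity alone, so it is a map on the temperatures only.
  With the constant weights \<open>M a = J a * P a * \<rho> a / \<rho>\<^sub>m\<^sub>i\<^sub>n\<close> and \<open>\<sigma> = (\<gamma> - 1) / Rg * \<theta>\<close>
  it moves each \<open>T a\<close> towards the plain average by the fraction \<open>\<sigma> / M a\<close>. Capping \<open>\<theta>\<close> by the
  smallest weight keeps these fractions in \<open>[0, 1]\<close>, so the new temperature is a convex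
  combination of the old one and the average. The energy sent to the points is proportional to
  the deviations from the average, whose sum is zero; this is conservation.

  Entropy: concavity of \<open>ln\<close> bounds the gain of \<open>M a * ln (T a)\<close> from below by
  \<open>\<sigma> * (ln (avg T) - ln (T a))\<close>. The weight cancels, and summing over the points leaves a
  quantity that is nonnegative by Jensen's inequality (\<open>sum_ln_relax_ge\<close>).

  Spread: every deviation from the average shrinks at least by the factor
  \<open>1 - \<sigma> / (MAX a. M a)\<close>, which yields the product bound (\<open>spread_relax_le\<close>).

  Convergence: the spread drops in each step by at least \<open>\<sigma> / (MAX a. M a)\<close> times its value,
  while a temperature moves by at most \<open>\<sigma> / M a\<close> times the spread. So the moves are dominated
  by a constant times the drops of a decreasing nonnegative sequence and are summable; every
  temperature converges, whatever the \<open>\<sigma>\<close> are (\<open>T_convergent\<close>). If the criterion failed at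
  the limit, then by continuity the factors \<open>\<sigma>\<close> would eventually stay above a positive
  constant. That forces the spread to \<open>0\<close> (\<open>limit_constant\<close>), so the limit temperature is
  uniform and the left-hand side of the criterion vanishes, a contradiction.\<close>

section \<open>Averages and extreme values over the solution points\<close>

lemma MIN_le: "(MIN a. f a) \<le> (f b :: real)" for f :: "'p::finite \<Rightarrow> real"
  by (intro Min_le) auto

lemma le_MAX: "f b \<le> (MAX a. f a :: real)" for f :: "'p::finite \<Rightarrow> real"
  by (intro Max_ge) auto

lemma MIN_greater_iff: "c < (MIN a. f a) \<longleftrightarrow> (\<forall>a. c < f a)" for f :: "'p::finite \<Rightarrow> real"
  by (subst Min_gr_iff) auto

lemma MIN_ge_iff: "c \<le> (MIN a. f a) \<longleftrightarrow> (\<forall>a. c \<le> f a)" for f :: "'p::finite \<Rightarrow> real"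
  by (subst Min_ge_iff) auto

lemma MAX_le_iff: "(MAX a. f a) \<le> c \<longleftrightarrow> (\<forall>a. f a \<le> c)" for f :: "'p::finite \<Rightarrow> real"
  by (subst Max_le_iff) auto

lemma sum_diff_avg: "(\<Sum>a\<in>UNIV. avg q - q a) = 0" for q :: "'p::finite \<Rightarrow> 'b::real_vector"
  by (simp add: sum_subtractf avg_def sum_constant_scaleR)

lemma avg_ge: "avg q \<ge> c" if "\<And>a. c \<le> q a" for q :: "'p::finite \<Rightarrow> real"
  using sum_bounded_below[of UNIV c q] that
  by (simp add: avg_def field_simps)

lemma avg_le: "avg q \<le> c" if "\<And>a. q a \<le> c" for q :: "'p::finite \<Rightarrow> real"
  using sum_bounded_above[of UNIV q c] that
  by (simp add: avg_def field_simps)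

lemma avg_pos: "avg q > 0" if "\<And>a. 0 < q a" for q :: "'p::finite \<Rightarrow> real"
  using that by (simp add: avg_def sum_pos)

lemma tendsto_avg:
  fixes q :: "nat \<Rightarrow> 'p::finite \<Rightarrow> 'b::real_normed_vector"
  assumes "\<And>a. (\<lambda>m. q m a) \<longlonglongrightarrow> l a"
  shows "(\<lambda>m. avg (q m)) \<longlonglongrightarrow> avg l"
  unfolding avg_def by (intro tendsto_intros assms)

text \<open>Jensen's inequality for the logarithm, from its tangent line at the average: the first-order
  terms add up to zero.\<close>

lemma sum_ln_le_sum_ln_avg:
  fixes T :: "'p::finite \<Rightarrow> real"
  assumes "\<And>a. 0 < T a"
  shows "(\<Sum>a\<in>UNIV. ln (T a)) \<le> (\<Sum>a::'p\<in>UNIV. ln (avg T))"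
proof -
  have "(\<Sum>a\<in>UNIV. ln (T a) - ln (avg T)) \<le> (\<Sum>a\<in>UNIV. (T a - avg T) / avg T)"
    by (intro sum_mono ln_diff_le assms avg_pos)
  also have "\<dots> = - (\<Sum>a\<in>UNIV. avg T - T a) / avg T"
    by (simp flip: sum_divide_distrib add: sum_subtractf)
  also have "\<dots> = 0"
    by (simp only: sum_diff_avg)
  finally show ?thesis
    by (simp add: sum_subtractf)
qed

definition spread :: "('p::finite \<Rightarrow> real) \<Rightarrow> real" where
  "spread T = (MAX a. T a) - (MIN a. T a)"

lemma abs_diff_le_spread: "\<bar>T a - T b\<bar> \<le> spread T"
  using MIN_le[of T a] MIN_le[of T b] le_MAX[of T a] le_MAX[of T b]
  unfolding spread_def by linarith

lemma spread_nonneg: "0 \<le> spread T"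
  using abs_diff_le_spread[of T undefined undefined] by simp

lemma abs_avg_diff_le_spread: "\<bar>avg T - T a\<bar> \<le> spread T"
proof -
  have "(MIN a. T a) \<le> avg T" by (intro avg_ge MIN_le)
  moreover have "avg T \<le> (MAX a. T a)" by (intro avg_le le_MAX)
  ultimately show ?thesis
    using MIN_le[of T a] le_MAX[of T a] unfolding spread_def by linarith
qed

section \<open>Relaxation of a field towards its average\<close>

definition relax :: "real \<Rightarrow> ('p::finite \<Rightarrow> real) \<Rightarrow> ('p \<Rightarrow> real) \<Rightarrow> 'p \<Rightarrow> real" where
  "relax \<sigma> M T a = T a + \<sigma> / M a * (avg T - T a)"

text \<open>Convexity gives the bound: neither the value nor the average lies below the minimum. It
  keeps iterated temperatures away from \<open>0\<close>, hence their limits positive.\<close>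

lemma relax_ge_MIN:
  assumes "\<And>a. 0 < M a" "0 \<le> \<sigma>" "\<And>a. \<sigma> \<le> M a"
  shows "(MIN a. T a) \<le> relax \<sigma> M T b"
proof -
  define w where "w = \<sigma> / M b"
  have w: "0 \<le> w" "w \<le> 1"
    using assms less_imp_le[OF assms(1)] by (auto simp: w_def)
  have "(MIN a. T a) \<le> avg T" by (intro avg_ge MIN_le)
  then have "(1 - w) * (MIN a. T a) + w * (MIN a. T a) \<le> (1 - w) * T b + w * avg T"
    using w MIN_le[of T b] by (intro add_mono mult_left_mono) auto
  also have "\<dots> = relax \<sigma> M T b"
    by (simp add: relax_def w_def algebra_simps)
  finally show ?thesis by (simp add: algebra_simps)
qed

text \<open>The deviation at \<open>a\<close> is multiplied by \<open>1 - \<sigma> / M a\<close>, and the largest weight gives the weakest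
  contraction. Maximum and minimum lie on either side of the average, so the two one-sided bounds
  add up to the spread.\<close>

lemma spread_relax_le:
  assumes M: "\<And>a. 0 < M a" and \<sigma>: "0 \<le> \<sigma>" "\<And>a. \<sigma> \<le> M a"
  shows "spread (relax \<sigma> M T) \<le> (1 - \<sigma> / (MAX a. M a)) * spread T"
proof -
  define K where "K = (MAX a. M a)"
  have K: "M a \<le> K" for a by (simp add: K_def le_MAX)
  have lower: "(MIN a. T a) \<le> avg T" by (intro avg_ge MIN_le)
  have upper: "avg T \<le> (MAX a. T a)" by (intro avg_le le_MAX)
  have w: "\<sigma> / K \<le> \<sigma> / M a" "\<sigma> / M a \<le> 1" for a
    using M \<sigma> K by (auto intro!: divide_left_mono mult_pos_pos less_le_trans[OF M K])
  have eq: "relax \<sigma> M T a - avg T = (1 - \<sigma> / M a) * (T a - avg T)" for a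
    by (simp add: relax_def algebra_simps)
  have "relax \<sigma> M T a - avg T \<le> (1 - \<sigma> / K) * ((MAX a. T a) - avg T)" for a
  proof -
    have "(1 - \<sigma> / M a) * (T a - avg T) \<le> (1 - \<sigma> / M a) * ((MAX a. T a) - avg T)"
      using w[of a] le_MAX[of T a] by (intro mult_left_mono) auto
    also have "\<dots> \<le> (1 - \<sigma> / K) * ((MAX a. T a) - avg T)"
      using w[of a] upper by (intro mult_right_mono) auto
    finally show ?thesis by (simp only: eq)
  qed
  then have max: "(MAX a. relax \<sigma> M T a) \<le> avg T + (1 - \<sigma> / K) * ((MAX a. T a) - avg T)"
    by (simp add: MAX_le_iff diff_le_eq add.commute)
  have "avg T - relax \<sigma> M T a \<le> (1 - \<sigma> / K) * (avg T - (MIN a. T a))" for a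
  proof -
    have "(1 - \<sigma> / M a) * (avg T - T a) \<le> (1 - \<sigma> / M a) * (avg T - (MIN a. T a))"
      using w[of a] MIN_le[of T a] by (intro mult_left_mono) auto
    also have "\<dots> \<le> (1 - \<sigma> / K) * (avg T - (MIN a. T a))"
      using w[of a] lower by (intro mult_right_mono) auto
    also have "(1 - \<sigma> / M a) * (avg T - T a) = avg T - relax \<sigma> M T a"
      by (simp add: relax_def algebra_simps)
    finally show ?thesis .
  qed
  then have min: "avg T - (1 - \<sigma> / K) * (avg T - (MIN a. T a)) \<le> (MIN a. relax \<sigma> M T a)"
    by (simp add: MIN_ge_iff diff_le_eq add.commute)
  have "spread (relax \<sigma> M T)
      \<le> (1 - \<sigma> / K) * ((MAX a. T a) - avg T) + (1 - \<sigma> / K) * (avg T - (MIN a. T a))"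
    using max min unfolding spread_def by linarith
  also have "\<dots> = (1 - \<sigma> / K) * spread T"
    unfolding spread_def by (simp flip: distrib_left)
  finally show ?thesis by (simp add: K_def)
qed

text \<open>Concavity of \<open>ln\<close> turns the fraction \<open>\<sigma> / M a\<close> into a gain of at least
  \<open>\<sigma> * (ln (avg T) - ln (T a))\<close>, with the same factor \<open>\<sigma>\<close> at all points. Only for this reason does
  the unweighted Jensen inequality suffice although the sum is weighted by \<open>M\<close>.\<close>

lemma sum_ln_relax_ge:
  fixes T :: "'p::finite \<Rightarrow> real"
  assumes M: "\<And>a. 0 < M a" and \<sigma>: "0 \<le> \<sigma>" "\<And>a. \<sigma> \<le> M a" and T: "\<And>a. 0 < T a"
  shows "(\<Sum>a\<in>UNIV. M a * ln (T a)) \<le> (\<Sum>a\<in>UNIV. M a * ln (relax \<sigma> M T a))"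
proof -
  have "\<sigma> * (ln (avg T) - ln (T a)) \<le> M a * (ln (relax \<sigma> M T a) - ln (T a))" for a
  proof -
    define w where "w = \<sigma> / M a"
    have w: "0 \<le> w" "w \<le> 1"
      using M less_imp_le[OF M] \<sigma> by (auto simp: w_def)
    have "(1 - w) * ln (T a) + w * ln (avg T) \<le> ln ((1 - w) * T a + w * avg T)"
      using concave_onD[OF ln_concave w, of "T a" "avg T"] T avg_pos[of T] by simp
    also have "(1 - w) * T a + w * avg T = relax \<sigma> M T a"
      by (simp add: relax_def w_def algebra_simps)
    finally have "w * (ln (avg T) - ln (T a)) \<le> ln (relax \<sigma> M T a) - ln (T a)"
      by (simp add: algebra_simps)
    then have "M a * (w * (ln (avg T) - ln (T a))) \<le> M a * (ln (relax \<sigma> M T a) - ln (T a))"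
      using M[of a] by (intro mult_left_mono) auto
    moreover have "M a * w = \<sigma>" using M[of a] by (simp add: w_def)
    ultimately show ?thesis by (simp flip: mult.assoc)
  qed
  then have "(\<Sum>a\<in>UNIV. \<sigma> * (ln (avg T) - ln (T a)))
      \<le> (\<Sum>a\<in>UNIV. M a * (ln (relax \<sigma> M T a) - ln (T a)))"
    by (intro sum_mono)
  moreover have "0 \<le> (\<Sum>a\<in>UNIV. \<sigma> * (ln (avg T) - ln (T a)))"
    unfolding sum_distrib_left[symmetric] sum_subtractf
    using sum_ln_le_sum_ln_avg[OF T] \<sigma>(1) by (intro mult_nonneg_nonneg) auto
  ultimately show ?thesis
    by (simp add: right_diff_distrib sum_subtractf)
qed

section \<open>Convergence of repeated relaxation\<close>

text \<open>The factors \<open>\<sigma> m\<close> are an arbitrary given sequence, so that the convergence argument does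
  not depend on how the limiter chooses them.\<close>

locale relaxation =
  fixes M :: "'p::finite \<Rightarrow> real" and \<sigma> :: "nat \<Rightarrow> real" and T :: "nat \<Rightarrow> 'p \<Rightarrow> real"
  assumes M_pos: "0 < M a"
    and \<sigma>_nonneg: "0 \<le> \<sigma> m"
    and \<sigma>_le: "\<sigma> m \<le> M a"
    and T_Suc: "T (Suc m) = relax (\<sigma> m) M (T m)"
begin

lemma M_le_MAX: "M a \<le> (MAX a. M a)"
  by (rule le_MAX)

lemma MAX_pos: "0 < (MAX a. M a)"
  using M_pos M_le_MAX by (rule less_le_trans)

lemma \<sigma>_div_MAX_le_1: "\<sigma> m / (MAX a. M a) \<le> 1"
  using order_trans[OF \<sigma>_le M_le_MAX] MAX_pos by (simp add: divide_le_eq)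

lemma spread_Suc_le: "spread (T (Suc m)) \<le> (1 - \<sigma> m / (MAX a. M a)) * spread (T m)"
  unfolding T_Suc by (intro spread_relax_le M_pos \<sigma>_nonneg \<sigma>_le)

lemma spread_le_prod: "spread (T m) \<le> spread (T 0) * (\<Prod>n<m. 1 - \<sigma> n / (MAX a. M a))"
proof (induction m)
  case (Suc m)
  have "spread (T (Suc m)) \<le> (1 - \<sigma> m / (MAX a. M a)) * spread (T m)"
    by (rule spread_Suc_le)
  also have "\<dots> \<le> (1 - \<sigma> m / (MAX a. M a)) * (spread (T 0) * (\<Prod>n<m. 1 - \<sigma> n / (MAX a. M a)))"
    using \<sigma>_div_MAX_le_1[of m] by (intro mult_left_mono Suc.IH) auto
  finally show ?case by (simp add: mult_ac)
qed simp

lemma T_ge_MIN: "(MIN a. T 0 a) \<le> T m b"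
proof (induction m arbitrary: b)
  case (Suc m)
  have "(MIN a. T 0 a) \<le> (MIN a. T m a)"
    unfolding MIN_ge_iff[of _ "T m"] using Suc.IH by blast
  also have "\<dots> \<le> T (Suc m) b"
    unfolding T_Suc by (intro relax_ge_MIN M_pos \<sigma>_nonneg \<sigma>_le)
  finally show ?case .
qed (rule MIN_le)

lemma T_pos:
  assumes "\<And>a. 0 < T 0 a"
  shows "0 < T m a"
proof -
  have "0 < (MIN a. T 0 a)" unfolding MIN_greater_iff using assms by blast
  then show ?thesis using T_ge_MIN[of m a] by linarith
qed

text \<open>Read as a lower bound on the drop of the spread: the drops have a finite sum, which controls
  everything weighted by \<open>\<sigma> m\<close>.\<close>

lemma spread_decrement: "\<sigma> m / (MAX a. M a) * spread (T m) \<le> spread (T m) - spread (T (Suc m))"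
  using spread_Suc_le[of m] by (simp add: algebra_simps)

lemma spread_convergent: "convergent (\<lambda>m. spread (T m))"
proof -
  have "0 \<le> \<sigma> m / (MAX a. M a) * spread (T m)" for m
    using \<sigma>_nonneg[of m] MAX_pos spread_nonneg[of "T m"] by auto
  from order_trans[OF this spread_decrement]
  have "spread (T (Suc m)) \<le> spread (T m)" for m
    by (simp only: diff_ge_0_iff_ge)
  then have "decseq (\<lambda>m. spread (T m))"
    by (rule decseq_SucI)
  then show ?thesis
    by (rule decseq_convergent[of _ 0]) (auto simp: spread_nonneg convergent_def)
qed

text \<open>A step at \<open>a\<close> has length at most \<open>\<sigma> / M a\<close> times the spread, and the drop of the spread pays
  for it up to the ratio between the largest weight and \<open>M a\<close>.\<close>

lemma step_le_spread_decrement: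
  "\<bar>T (Suc m) a - T m a\<bar> \<le> (MAX a. M a) / M a * (spread (T m) - spread (T (Suc m)))"
proof -
  have "\<bar>T (Suc m) a - T m a\<bar> = \<sigma> m / M a * \<bar>avg (T m) - T m a\<bar>"
    using M_pos[of a] \<sigma>_nonneg[of m] by (simp add: T_Suc relax_def abs_mult)
  also have "\<dots> \<le> \<sigma> m / M a * spread (T m)"
    using M_pos[of a] \<sigma>_nonneg[of m] by (intro mult_left_mono abs_avg_diff_le_spread) auto
  also have "\<dots> = (MAX a. M a) / M a * (\<sigma> m / (MAX a. M a) * spread (T m))"
    using MAX_pos by simp
  also have "\<dots> \<le> (MAX a. M a) / M a * (spread (T m) - spread (T (Suc m)))"
    using MAX_pos M_pos[of a] by (intro mult_left_mono spread_decrement) auto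
  finally show ?thesis .
qed

text \<open>The steps are dominated by a telescoping series, so the sequence converges even if the \<open>\<sigma> m\<close>
  are so small that the spread does not tend to \<open>0\<close>.\<close>

lemma T_convergent: "convergent (\<lambda>m. T m a)"
proof -
  obtain R where "(\<lambda>m. spread (T m)) \<longlonglongrightarrow> R"
    using spread_convergent by (auto simp: convergent_def)
  then have "summable (\<lambda>m. (MAX a. M a) / M a * (spread (T m) - spread (T (Suc m))))"
    by (intro summable_mult telescope_summable')
  then have "summable (\<lambda>m. T (Suc m) a - T m a)"
    by (rule summable_comparison_test[rotated]) (use step_le_spread_decrement in auto)
  then have "convergent (\<lambda>n. T n a - T 0 a)"
    by (simp add: summable_iff_convergent sum_lessThan_telescope[of "\<lambda>m. T m a"])
  then show ?thesis
    by (simp add: convergent_diff_const_right_iff)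
qed

text \<open>The limit \<open>R\<close> of the spreads satisfies \<open>c / (MAX a. M a) * R \<le> R - R\<close>, hence vanishes:
  relaxation fractions bounded away from \<open>0\<close> flatten the field.\<close>

lemma limit_constant:
  assumes T: "\<And>a. (\<lambda>m. T m a) \<longlonglongrightarrow> l a"
    and c: "0 < c" "eventually (\<lambda>m. c \<le> \<sigma> m) sequentially"
  shows "l a = avg l"
proof -
  obtain R where R: "(\<lambda>m. spread (T m)) \<longlonglongrightarrow> R"
    using spread_convergent by (auto simp: convergent_def)
  have "c / (MAX a. M a) * R \<le> R - R"
  proof (rule tendsto_le)
    show "(\<lambda>m. spread (T m) - spread (T (Suc m))) \<longlonglongrightarrow> R - R"
      by (intro tendsto_diff R LIMSEQ_Suc)
    show "(\<lambda>m. c / (MAX a. M a) * spread (T m)) \<longlonglongrightarrow> c / (MAX a. M a) * R"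
      by (intro tendsto_mult_left R)
    show "\<forall>\<^sub>F m in sequentially. c / (MAX a. M a) * spread (T m) \<le> spread (T m) - spread (T (Suc m))"
      using c(2)
    proof eventually_elim
      case (elim m)
      have "c / (MAX a. M a) * spread (T m) \<le> \<sigma> m / (MAX a. M a) * spread (T m)"
        using elim MAX_pos by (intro mult_right_mono divide_right_mono spread_nonneg) auto
      then show ?case using spread_decrement[of m] by linarith
    qed
  qed simp
  moreover have "0 \<le> R"
    by (rule LIMSEQ_le_const[OF R]) (simp add: spread_nonneg)
  moreover have "0 < c / (MAX a. M a)"
    using c MAX_pos by simp
  ultimately have "R = 0"
    using mult_pos_pos[of "c / (MAX a. M a)" R] by linarith
  have "\<bar>avg l - l a\<bar> \<le> R"
  proof (rule tendsto_le[OF _ R])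
    show "(\<lambda>m. \<bar>avg (T m) - T m a\<bar>) \<longlonglongrightarrow> \<bar>avg l - l a\<bar>"
      by (intro tendsto_intros tendsto_avg T)
  qed (auto simp: abs_avg_diff_le_spread)
  then show ?thesis using \<open>R = 0\<close> by simp
qed

end

section \<open>The temperature limiter\<close>

lemma mass_density_add_energy [simp]: "mass_density (U + e *\<^sub>R (0, 0, d)) = mass_density U"
  by (simp add: mass_density_def)

lemma velocity_add_energy [simp]: "velocity (U + e *\<^sub>R (0, 0, d)) = velocity U"
  by (simp add: velocity_def mass_density_def)

lemma temperature_add_energy:
  "temperature Rg \<gamma> (U + e *\<^sub>R (0, 0, d))
     = temperature Rg \<gamma> U + (\<gamma> - 1) / Rg * (e * d / mass_density U)"
proof -
  have "total_energy (U + e *\<^sub>R (0, 0, d)) = total_energy U + e * d / mass_density U"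
    by (simp add: total_energy_def mass_density_def add_divide_distrib)
  then show ?thesis
    unfolding temperature_def velocity_add_energy by (simp add: algebra_simps)
qed

text \<open>Once density and velocity are fixed, convergence of the states reduces to convergence of the
  temperatures.\<close>

lemma state_eq_primitive:
  assumes "Rg > 0" "\<gamma> > 1" "mass_density U > 0"
  shows "U = (mass_density U, mass_density U *\<^sub>R velocity U,
    mass_density U * (Rg * temperature Rg \<gamma> U / (\<gamma> - 1) + (norm (velocity U))\<^sup>2 / 2))"
  using assms
  by (cases U) (simp add: temperature_def total_energy_def velocity_def mass_density_def)

lemma velocity_primitive [simp]: "\<rho> \<noteq> 0 \<Longrightarrow> velocity (\<rho>, \<rho> *\<^sub>R V, e) = V"
  by (simp add: velocity_def mass_density_def)

lemma mass_density_primitive [simp]: "mass_density (\<rho>, v, e) = \<rho>"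
  by (simp add: mass_density_def)

lemma rho_min_pos: "0 < rho_min U" if "\<And>a. 0 < mass_density (U a)"
  unfolding rho_min_def MIN_greater_iff using that by blast

lemma mass_ratio_pos:
  assumes "\<And>a. 0 < J a" "\<And>a. 0 < P a" "\<And>a. 0 < mass_density (U a)"
  shows "0 < mass_ratio J P U a"
  using assms rho_min_pos[of U] by (simp add: mass_ratio_def)

lemma rho_H_pos: "0 < rho_H U a" if "\<And>a. 0 < mass_density (U a)"
  unfolding rho_H_def harmonic_avg_def
  using that avg_pos[of "\<lambda>b. mass_density (U b)"] by (simp add: add_pos_pos)

text \<open>The left-hand side of the temperature criterion.\<close>

definition temp_jump :: "real \<Rightarrow> real \<Rightarrow> ('p::finite \<Rightarrow> cons_state) \<Rightarrow> 'p \<Rightarrow> real" where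
  "temp_jump Rg \<gamma> U a = lambda_tilde Rg \<gamma> U a
     * (\<bar>temperature Rg \<gamma> (U a) - avg_temperature Rg \<gamma> U\<bar>
        / (temperature Rg \<gamma> (U a) * avg_temperature Rg \<gamma> U))"

text \<open>With the criterion written as \<open>jump \<le> bound\<close>, the correction at a point is proportional to
  \<open>1 - bound / jump\<close>, which for a positive bound is nonnegative when active and increases with
  the jump. The identity covers vanishing denominators because of \<open>x / 0 = 0\<close>.\<close>

lemma theta_point_eq:
  "theta_point Rg \<gamma> \<mu> h J P U a =
     (if temp_jump Rg \<gamma> U a > rho_H U a * h / \<mu>
      then mass_ratio J P U a * (Rg / (\<gamma> - 1)) * (1 - rho_H U a * h / \<mu> / temp_jump Rg \<gamma> U a)
      else 0)"
  unfolding theta_point_def Let_def temp_jump_def by (simp add: divide_simps mult_ac)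

lemma theta_point_nonneg:
  assumes "Rg > 0" "\<gamma> > 1" "\<mu> > 0" "h > 0" "\<And>a. 0 < J a" "\<And>a. 0 < P a"
    "\<And>a. 0 < mass_density (U a)"
  shows "0 \<le> theta_point Rg \<gamma> \<mu> h J P U a"
proof (cases "temp_jump Rg \<gamma> U a > rho_H U a * h / \<mu>")
  case True
  have "0 < rho_H U a * h / \<mu>" using rho_H_pos[of U a] assms by simp
  with True have "rho_H U a * h / \<mu> / temp_jump Rg \<gamma> U a \<le> 1"
    by (subst divide_le_eq_1) linarith
  moreover have "0 < mass_ratio J P U a" using assms by (intro mass_ratio_pos)
  ultimately show ?thesis
    using assms by (auto simp: theta_point_eq)
qed (simp add: theta_point_eq)

lemma limiter_theta_nonneg:
  assumes "Rg > 0" "\<gamma> > 1" "\<mu> > 0" "h > 0" "\<And>a. 0 < J a" "\<And>a. 0 < P a"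
    "\<And>a. 0 < mass_density (U a)"
  shows "0 \<le> limiter_theta Rg \<gamma> \<mu> h J P U"
proof -
  have "0 \<le> theta_point Rg \<gamma> \<mu> h J P U undefined"
    using assms by (rule theta_point_nonneg)
  also have "\<dots> \<le> (MAX a. theta_point Rg \<gamma> \<mu> h J P U a)"
    by (rule le_MAX)
  finally have "0 \<le> (MAX a. theta_point Rg \<gamma> \<mu> h J P U a)" .
  moreover have "0 \<le> (MIN a. mass_ratio J P U a)"
    unfolding MIN_ge_iff using assms by (intro allI less_imp_le mass_ratio_pos)
  with assms(1,2) have "0 \<le> Rg / (\<gamma> - 1) * (MIN a. mass_ratio J P U a)"
    by (intro mult_nonneg_nonneg) auto
  ultimately show ?thesis
    by (simp add: limiter_theta_def)
qed

text \<open>The cap in the definition of \<open>\<theta>\<close> is exactly what makes the relaxation fractions at most \<open>1\<close>.\<close>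

lemma limiter_theta_le:
  assumes "Rg > 0" "\<gamma> > 1"
  shows "(\<gamma> - 1) / Rg * limiter_theta Rg \<gamma> \<mu> h J P U \<le> mass_ratio J P U a"
proof -
  have "limiter_theta Rg \<gamma> \<mu> h J P U \<le> Rg / (\<gamma> - 1) * (MIN a. mass_ratio J P U a)"
    by (simp add: limiter_theta_def)
  also have "\<dots> \<le> Rg / (\<gamma> - 1) * mass_ratio J P U a"
    using assms by (intro mult_left_mono MIN_le) auto
  finally show ?thesis using assms by (simp add: field_simps)
qed

lemma tendsto_temp_jump:
  fixes U :: "nat \<Rightarrow> 'p::finite \<Rightarrow> cons_state"
  assumes vel: "\<And>m a. velocity (U m a) = velocity (L a)"
    and T: "\<And>a. (\<lambda>m. temperature Rg \<gamma> (U m a)) \<longlonglongrightarrow> temperature Rg \<gamma> (L a)"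
    and pos: "\<And>a. 0 < temperature Rg \<gamma> (L a)"
  shows "(\<lambda>m. temp_jump Rg \<gamma> (U m) a) \<longlonglongrightarrow> temp_jump Rg \<gamma> L a"
proof -
  have Tb: "(\<lambda>m. avg_temperature Rg \<gamma> (U m)) \<longlonglongrightarrow> avg_temperature Rg \<gamma> L"
    unfolding avg_temperature_def by (intro tendsto_avg T)
  have "0 < avg_temperature Rg \<gamma> L"
    unfolding avg_temperature_def by (intro avg_pos pos)
  with pos[of a] have "temperature Rg \<gamma> (L a) * avg_temperature Rg \<gamma> L \<noteq> 0"
    by simp
  then show ?thesis
    unfolding temp_jump_def lambda_tilde_def sound_speed_def vel
    by (intro tendsto_intros T Tb) auto
qed

theorem theorem10:
  fixes Rg \<gamma> \<mu> h s0 :: real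
    and J P :: "'p::finite \<Rightarrow> real"
    and U Uh :: "nat \<Rightarrow> 'p \<Rightarrow> cons_state"
  assumes "Rg > 0" and "\<gamma> > 1" and "\<mu> > 0" and "h > 0"
    and "\<And>a. J a > 0" and "\<And>a. P a > 0"
    and scaled: "\<And>m a. Uh m a = J a *\<^sub>R U m a"
    and iter: "\<And>m. Uh (Suc m) = limiter_step Rg \<gamma> \<mu> h J P (Uh m)"
    and init_density: "\<And>a. mass_density (U 0 a) > 0"
    and init_temperature: "\<And>a. temperature Rg \<gamma> (U 0 a) > 0"
  shows
    "(\<forall>m a. mass_density (U m a) > 0 \<and> temperature Rg \<gamma> (U m a) > 0)
     \<and>
     (\<forall>m. (\<Sum>a\<in>UNIV. P a *\<^sub>R Uh (Suc m) a) = (\<Sum>a\<in>UNIV. P a *\<^sub>R Uh m a))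
     \<and>
     (\<forall>m. (\<Sum>a\<in>UNIV. P a * J a * math_entropy Rg \<gamma> s0 (U (Suc m) a))
          \<le> (\<Sum>a\<in>UNIV. P a * J a * math_entropy Rg \<gamma> s0 (U m a)))
     \<and>
     (\<forall>m\<ge>1.
        (MAX a. temperature Rg \<gamma> (U m a)) - (MIN a. temperature Rg \<gamma> (U m a))
        \<le> ((MAX a. temperature Rg \<gamma> (U 0 a)) - (MIN a. temperature Rg \<gamma> (U 0 a)))
          * (\<Prod>n=1..m. 1 - (\<gamma> - 1) / Rg
               * (limiter_theta Rg \<gamma> \<mu> h J P (U (n - 1))
                  / (MAX a. mass_ratio J P (U (n - 1)) a))))
     \<and>
     (\<exists>L :: 'p \<Rightarrow> cons_state.
        (\<forall>a. (\<lambda>m. U m a) \<longlonglongrightarrow> L a) \<and>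
        (\<forall>a. mass_density (L a) > 0 \<and> temperature Rg \<gamma> (L a) > 0) \<and>
        (\<forall>a. lambda_tilde Rg \<gamma> L a
               * (\<bar>temperature Rg \<gamma> (L a) - avg_temperature Rg \<gamma> L\<bar>
                  / (temperature Rg \<gamma> (L a) * avg_temperature Rg \<gamma> L))
             \<le> rho_H L a * h / \<mu>))"
proof -
  have step: "U (Suc m) a = U m a +
      (limiter_theta Rg \<gamma> \<mu> h J P (U m) * rho_min (U m) / (J a * P a))
        *\<^sub>R (0, 0, avg_temperature Rg \<gamma> (U m) - temperature Rg \<gamma> (U m a))" for m a
  proof -
    have unscaled: "(\<lambda>a. Uh m a /\<^sub>R J a) = U m"
      using assms(5) by (auto simp: scaled less_imp_neq[symmetric])
    have "Uh (Suc m) a = Uh m a +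
      (limiter_theta Rg \<gamma> \<mu> h J P (U m) / P a * rho_min (U m))
        *\<^sub>R (0, 0, avg_temperature Rg \<gamma> (U m) - temperature Rg \<gamma> (U m a))"
      unfolding iter limiter_step_def Let_def unscaled ..
    then have "J a *\<^sub>R U (Suc m) a = J a *\<^sub>R U m a +
      (limiter_theta Rg \<gamma> \<mu> h J P (U m) / P a * rho_min (U m))
        *\<^sub>R (0, 0, avg_temperature Rg \<gamma> (U m) - temperature Rg \<gamma> (U m a))"
      unfolding scaled .
    then have "inverse (J a) *\<^sub>R J a *\<^sub>R U (Suc m) a = inverse (J a) *\<^sub>R (J a *\<^sub>R U m a +
      (limiter_theta Rg \<gamma> \<mu> h J P (U m) / P a * rho_min (U m))
        *\<^sub>R (0, 0, avg_temperature Rg \<gamma> (U m) - temperature Rg \<gamma> (U m a)))"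
      by simp
    then show ?thesis
      using assms(5)[of a] by (simp add: scaleR_add_right divide_inverse mult_ac)
  qed
  define \<rho> where "\<rho> a = mass_density (U 0 a)" for a
  define v where "v a = velocity (U 0 a)" for a
  define r where "r = (MIN a. \<rho> a)"
  define M where "M a = J a * P a * (\<rho> a / r)" for a
  have density: "mass_density (U m a) = \<rho> a" for m a
    by (induction m) (simp_all only: \<rho>_def step mass_density_add_energy)
  have velocity: "velocity (U m a) = v a" for m a
    by (induction m) (simp_all only: v_def step velocity_add_energy)
  have rho_min: "rho_min (U m) = r" for m
    unfolding rho_min_def density r_def ..
  have rho_H: "rho_H (U m) a = harmonic_avg (\<rho> a) (avg \<rho>)" for m a
    unfolding rho_H_def density ..
  have mass_ratio: "mass_ratio J P (U m) = M" for m
    by (rule ext) (simp only: mass_ratio_def density rho_min M_def)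
  have \<rho>_pos: "0 < \<rho> a" for a
    unfolding \<rho>_def by (rule init_density)
  have density_pos: "0 < mass_density (U m a)" for m a
    unfolding density by (rule \<rho>_pos)
  have r_pos: "0 < r"
    unfolding r_def MIN_greater_iff using \<rho>_pos by blast

  define T where "T m a = temperature Rg \<gamma> (U m a)" for m a
  define \<theta> where "\<theta> m = limiter_theta Rg \<gamma> \<mu> h J P (U m)" for m
  define k where "k = (\<gamma> - 1) / Rg"
  have k: "0 < k" using assms(1,2) by (simp add: k_def)
  have avgT: "avg_temperature Rg \<gamma> (U m) = avg (T m)" for m
    by (simp add: avg_temperature_def T_def[abs_def])

  interpret relaxation M "\<lambda>m. k * \<theta> m" T
  proof
    show "0 < M a" for a
      unfolding M_def using assms(5,6) \<rho>_pos r_pos by simp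
    show "0 \<le> k * \<theta> m" for m
      unfolding \<theta>_def using k assms density_pos by (intro mult_nonneg_nonneg limiter_theta_nonneg) auto
    show "k * \<theta> m \<le> M a" for m a
      unfolding k_def \<theta>_def mass_ratio[of m, symmetric] by (intro limiter_theta_le assms)
    show "T (Suc m) = relax (k * \<theta> m) M (T m)" for m
    proof
      fix a
      have "k * \<theta> m / M a = k * (\<theta> m * r / (J a * P a) / \<rho> a)"
        using r_pos \<rho>_pos[of a] by (simp add: M_def)
      then show "T (Suc m) a = relax (k * \<theta> m) M (T m) a"
        unfolding relax_def T_def[of "Suc m"] step temperature_add_energy
        by (simp add: T_def[symmetric] avgT density rho_min \<theta>_def k_def)
    qed
  qed

  have pos: "0 < T m a" for m a
    by (rule T_pos) (simp add: T_def init_temperature)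

  \<comment> \<open>The weight \<open>P a\<close> cancels the \<open>1 / P a\<close> of the update, so the increments carry a common factor.\<close>
  have conserve: "(\<Sum>a\<in>UNIV. P a *\<^sub>R Uh (Suc m) a) = (\<Sum>a\<in>UNIV. P a *\<^sub>R Uh m a)" for m
  proof -
    have "P a *\<^sub>R Uh (Suc m) a = P a *\<^sub>R Uh m a
        + (0, 0, \<theta> m * rho_min (U m) * (avg (T m) - T m a))" for a
      using assms(5,6)[of a]
      by (simp add: scaled step scaleR_add_right avgT \<theta>_def T_def)
    then have "(\<Sum>a\<in>UNIV. P a *\<^sub>R Uh (Suc m) a) = (\<Sum>a\<in>UNIV. P a *\<^sub>R Uh m a)
        + (\<Sum>a\<in>UNIV. (\<theta> m * rho_min (U m)) *\<^sub>R (0, 0, avg (T m) - T m a))"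
      by (simp add: sum.distrib)
    also have "(\<Sum>a\<in>UNIV. (\<theta> m * rho_min (U m)) *\<^sub>R (0 :: real, 0 :: real^3, avg (T m) - T m a))
        = (\<theta> m * rho_min (U m)) *\<^sub>R (0, 0, \<Sum>a\<in>UNIV. avg (T m) - T m a)"
      by (simp only: scaleR_sum_right[symmetric] sum_prod sum.neutral_const)
    also have "\<dots> = 0"
      by (simp only: sum_diff_avg) (simp add: zero_prod_def)
    finally show ?thesis by simp
  qed

  \<comment> \<open>Density terms and the constant \<open>s0\<close> do not change; only the weighted sum of \<open>ln T\<close> matters.\<close>
  have entropy: "(\<Sum>a\<in>UNIV. P a * J a * math_entropy Rg \<gamma> s0 (U (Suc m) a))
      \<le> (\<Sum>a\<in>UNIV. P a * J a * math_entropy Rg \<gamma> s0 (U m a))" for m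
  proof -
    define C where "C = (\<Sum>a\<in>UNIV. P a * J a * \<rho> a * (Rg * ln (\<rho> a) - s0))"
    have "P a * J a * math_entropy Rg \<gamma> s0 (U m a)
        = P a * J a * \<rho> a * (Rg * ln (\<rho> a) - s0) - r / k * (M a * ln (T m a))" for m a
    proof -
      have "r / k * (M a * ln (T m a)) = P a * J a * \<rho> a * (Rg / (\<gamma> - 1) * ln (T m a))"
        using r_pos by (simp add: M_def k_def)
      then show ?thesis
        by (simp add: math_entropy_def specific_entropy_def density T_def right_diff_distrib
            distrib_left mult_ac)
    qed
    then have eq: "(\<Sum>a\<in>UNIV. P a * J a * math_entropy Rg \<gamma> s0 (U m a))
        = C - r / k * (\<Sum>a\<in>UNIV. M a * ln (T m a))" for m
      by (simp add: C_def sum_subtractf sum_distrib_left)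
    have "(\<Sum>a\<in>UNIV. M a * ln (T m a)) \<le> (\<Sum>a\<in>UNIV. M a * ln (T (Suc m) a))"
      unfolding T_Suc by (intro sum_ln_relax_ge M_pos \<sigma>_nonneg \<sigma>_le pos)
    then have "r / k * (\<Sum>a\<in>UNIV. M a * ln (T m a))
        \<le> r / k * (\<Sum>a\<in>UNIV. M a * ln (T (Suc m) a))"
      using k r_pos by (intro mult_left_mono) auto
    then show ?thesis unfolding eq by linarith
  qed

  have spread: "spread (T m) \<le> spread (T 0)
      * (\<Prod>n=1..m. 1 - k * (\<theta> (n - 1) / (MAX a. mass_ratio J P (U (n - 1)) a)))" for m
  proof -
    have "(\<Prod>n<m. 1 - k * \<theta> n / (MAX a. M a))
        = (\<Prod>n=1..m. 1 - k * (\<theta> (n - 1) / (MAX a. mass_ratio J P (U (n - 1)) a)))"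
      by (rule prod.reindex_bij_witness[of _ "\<lambda>n. n - 1" Suc])
        (auto simp: mass_ratio)
    then show ?thesis using spread_le_prod[of m] by simp
  qed

  obtain l where l: "\<And>a. (\<lambda>m. T m a) \<longlonglongrightarrow> l a"
    using T_convergent unfolding convergent_def by metis
  have l_pos: "0 < l a" for a
  proof -
    have "(MIN a. T 0 a) \<le> l a"
      by (rule LIMSEQ_le_const[OF l]) (simp add: T_ge_MIN)
    moreover have "0 < (MIN a. T 0 a)" unfolding MIN_greater_iff using pos by blast
    ultimately show ?thesis by linarith
  qed
  define prim where "prim t a = (\<rho> a, \<rho> a *\<^sub>R v a,
      \<rho> a * (Rg * t / (\<gamma> - 1) + (norm (v a))\<^sup>2 / 2))" for t a
  define L where "L a = prim (l a) a" for a
  have U_prim: "U m a = prim (T m a) a" for m a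
    using state_eq_primitive[OF assms(1,2) density_pos, of m a]
    unfolding prim_def T_def density velocity .
  have conv: "(\<lambda>m. U m a) \<longlonglongrightarrow> L a" for a
    unfolding U_prim L_def prim_def using assms(2) by (intro tendsto_intros l) auto
  have L_density: "mass_density (L a) = \<rho> a" for a
    by (simp add: L_def prim_def)
  have L_velocity: "velocity (L a) = v a" for a
    using \<rho>_pos[of a] by (simp add: L_def prim_def)
  have L_temperature: "temperature Rg \<gamma> (L a) = l a" for a
    unfolding L_def prim_def by (intro temperature_of_primitive assms \<rho>_pos)
  have L_rho_H: "rho_H L a = harmonic_avg (\<rho> a) (avg \<rho>)" for a
    unfolding rho_H_def L_density ..

  have fixed: "temp_jump Rg \<gamma> L a \<le> rho_H L a * h / \<mu>" for a
  proof (rule ccontr)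
    define b where "b = rho_H L a * h / \<mu>"
    assume "\<not> temp_jump Rg \<gamma> L a \<le> rho_H L a * h / \<mu>"
    then have jump: "b < temp_jump Rg \<gamma> L a" by (simp add: b_def)
    have b_pos: "0 < b"
      unfolding b_def using rho_H_pos[of L a] \<rho>_pos assms by (simp add: L_density)
    have lim: "(\<lambda>m. temp_jump Rg \<gamma> (U m) a) \<longlonglongrightarrow> temp_jump Rg \<gamma> L a"
      by (rule tendsto_temp_jump)
        (use l l_pos in \<open>auto simp: L_velocity velocity L_temperature T_def\<close>)
    obtain q where q: "b < q" "q < temp_jump Rg \<gamma> L a"
      using jump dense by blast
    \<comment> \<open>A level \<open>q\<close> strictly between bound and limit jump makes the lower bound \<open>c\<close> on \<open>\<theta>\<close> uniform in \<open>m\<close>;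
      its second argument is the cap in the definition of \<open>\<theta>\<close>.\<close>
    define c where "c = min (M a / k * (1 - b / q)) (1 / k * (MIN a. M a))"
    have "0 < (MIN a. M a)" unfolding MIN_greater_iff using M_pos by blast
    then have c: "0 < c"
      using q b_pos k M_pos[of a] by (simp add: c_def)
    have "\<forall>\<^sub>F m in sequentially. q < temp_jump Rg \<gamma> (U m) a"
      using lim q(2) by (rule order_tendstoD)
    then have "\<forall>\<^sub>F m in sequentially. k * c \<le> k * \<theta> m"
    proof eventually_elim
      case (elim m)
      have "b / temp_jump Rg \<gamma> (U m) a \<le> b / q"
        using elim q b_pos by (intro divide_left_mono mult_pos_pos) auto
      then have "M a / k * (1 - b / q) \<le> M a / k * (1 - b / temp_jump Rg \<gamma> (U m) a)"
        using M_pos[of a] k by (intro mult_left_mono) auto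
      also have "\<dots> = theta_point Rg \<gamma> \<mu> h J P (U m) a"
        using elim q by (simp add: theta_point_eq b_def L_rho_H rho_H mass_ratio k_def)
      also have "\<dots> \<le> (MAX a. theta_point Rg \<gamma> \<mu> h J P (U m) a)"
        by (rule le_MAX)
      finally have "c \<le> \<theta> m"
        unfolding c_def \<theta>_def limiter_theta_def mass_ratio k_def
        by (intro min.mono) auto
      then show ?case using k by simp
    qed
    with c k have "l a = avg l"
      by (intro limit_constant[OF l, of "k * c"]) auto
    then have "temp_jump Rg \<gamma> L a = 0"
      by (simp add: temp_jump_def avg_temperature_def L_temperature)
    with jump b_pos show False by simp
  qed

  show ?thesis
    using density_pos pos conserve entropy spread conv \<rho>_pos l_pos fixed
    unfolding T_def spread_def k_def \<theta>_def temp_jump_def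
    by (intro conjI exI[of _ L]) (auto simp: L_density L_temperature)
qed

end
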